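(* Let $G$ be a finite non-abelian group that is not isomorphic to a generalized dihedral group. Then $$\gamma(\mathcal{C}^{**}(G))\le (|G|-|Z(G)|)\cdot\min\left\{\frac{1+\ln(d+1)}{d+1},\ \frac12\right\},$$ where $d=\min_{g\in G\setminus Z(G)}\bigl(|C(g)|-|Z(G)|\bigr)$.
   Context: For a finite group $G$, the proper commuting graph $\mathcal{C}^{**}(G)$ is the simple graph with vertex set $G\setminus Z(G)$ in which two distinct vertices $x,y$ are adjacent if and only if $xy=yx$; $Z(G)$ is the center of $G$ and $C(g)$ is the centralizer of $g$ in $G$. A dominating set of a finite simple graph with vertex set $V$ is a subset $X\subseteq V$ such that every vertex of $V\setminus X$ is adjacent to some vertex of $X$; the domination number $\gamma$ is the minimum cardinality of a dominating set. For a finite abelian group $A$, the generalized dihedral group $D(A)$ is the semidirect product of $A$ with a cyclic group $\langle x\rangle$ of order $2$, where $x^{-1}ax=a^{-1}$ for all $a\in A$. *)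

theory Defs
  imports
    Complex_Main
    "HOL-Algebra.Algebra"
    "Graph_Theory.Graph_Theory"
begin

section \<open>Center and centralizers\<close>

definition group_center :: "('a, 'b) monoid_scheme \<Rightarrow> 'a set" where
  "group_center G = {z \<in> carrier G. \<forall>g \<in> carrier G. z \<otimes>\<^bsub>G\<^esub> g = g \<otimes>\<^bsub>G\<^esub> z}"

definition centralizer :: "('a, 'b) monoid_scheme \<Rightarrow> 'a \<Rightarrow> 'a set" where
  "centralizer G g = {h \<in> carrier G. h \<otimes>\<^bsub>G\<^esub> g = g \<otimes>\<^bsub>G\<^esub> h}"

text \<open>The difference of cardinalities below is taken in the natural numbers; the following fact
  shows that it is not truncated.\<close>

lemma group_center_subset_centralizer:
  "g \<in> carrier G \<Longrightarrow> group_center G \<subseteq> centralizer G g"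
  by (auto simp: group_center_def centralizer_def)

definition min_centralizer_excess :: "('a, 'b) monoid_scheme \<Rightarrow> nat" where
  "min_centralizer_excess G =
     Min ((\<lambda>g. card (centralizer G g) - card (group_center G)) ` (carrier G - group_center G))"


section \<open>Domination in finite simple graphs\<close>

text \<open>Simple graphs are encoded as symmetric loop-free digraphs (locale \<^locale>\<open>pair_graph\<close>), so each
  undirected edge is a pair of opposite arcs.\<close>

definition dominating_set :: "'a pair_pre_digraph \<Rightarrow> 'a set \<Rightarrow> bool" where
  "dominating_set \<Gamma> S \<longleftrightarrow>
     S \<subseteq> pverts \<Gamma> \<and> (\<forall>y \<in> pverts \<Gamma> - S. \<exists>x \<in> S. (y, x) \<in> parcs \<Gamma>)"

definition domination_number :: "'a pair_pre_digraph \<Rightarrow> nat" where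
  "domination_number \<Gamma> = Min (card ` {S. dominating_set \<Gamma> S})"

definition proper_commuting_graph :: "('a, 'b) monoid_scheme \<Rightarrow> 'a pair_pre_digraph" where
  "proper_commuting_graph G =
     \<lparr> pverts = carrier G - group_center G,
       parcs = {(x, y). x \<in> carrier G - group_center G \<and> y \<in> carrier G - group_center G
                        \<and> x \<noteq> y \<and> x \<otimes>\<^bsub>G\<^esub> y = y \<otimes>\<^bsub>G\<^esub> x} \<rparr>"

lemma pair_graph_proper_commuting_graph:
  assumes "finite (carrier G)"
  shows "pair_graph (proper_commuting_graph G)"
proof -
  let ?V = "carrier G - group_center G"
  have "finite (?V \<times> ?V)" using assms by simp
  moreover have "parcs (proper_commuting_graph G) \<subseteq> ?V \<times> ?V"
    by (auto simp: proper_commuting_graph_def)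
  ultimately have "finite (parcs (proper_commuting_graph G))"
    by (rule finite_subset[rotated])
  then show ?thesis
    using assms
    by unfold_locales (auto simp: proper_commuting_graph_def symmetric_def sym_def)
qed


section \<open>Generalized dihedral groups\<close>

definition semidirect_product ::
    "('n, 'a) monoid_scheme \<Rightarrow> ('h, 'b) monoid_scheme \<Rightarrow> ('h \<Rightarrow> 'n \<Rightarrow> 'n) \<Rightarrow> ('n \<times> 'h) monoid" where
  "semidirect_product N H \<phi> =
     \<lparr> carrier = carrier N \<times> carrier H,
       monoid.mult = (\<lambda>(n, h) (n', h'). (n \<otimes>\<^bsub>N\<^esub> \<phi> h n', h \<otimes>\<^bsub>H\<^esub> h')),
       one = (\<one>\<^bsub>N\<^esub>, \<one>\<^bsub>H\<^esub>) \<rparr>"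

definition generalized_dihedral :: "('a, 'b) monoid_scheme \<Rightarrow> ('a \<times> int) monoid" where
  "generalized_dihedral A =
     semidirect_product A (integer_mod_group 2) (\<lambda>k a. if k = 0 then a else inv\<^bsub>A\<^esub> a)"

text \<open>The group \<open>A\<close> ranges over groups on the element type of \<open>G\<close>; by
  \<open>is_generalized_dihedralI\<close> below this is no restriction, since \<open>A\<close> embeds into \<open>G\<close>.\<close>

definition is_generalized_dihedral :: "('a, 'b) monoid_scheme \<Rightarrow> bool" where
  "is_generalized_dihedral G \<longleftrightarrow>
     (\<exists>A :: 'a monoid. comm_group A \<and> finite (carrier A) \<and> G \<cong> generalized_dihedral A)"

lemma carrier_generalized_dihedral:
  "carrier (generalized_dihedral A) = carrier A \<times> {0, 1}"
  by (auto simp: generalized_dihedral_def semidirect_product_def carrier_integer_mod_group)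

lemma one_generalized_dihedral: "\<one>\<^bsub>generalized_dihedral A\<^esub> = (\<one>\<^bsub>A\<^esub>, 0)"
  by (simp add: generalized_dihedral_def semidirect_product_def)

lemma mult_generalized_dihedral:
  "(a, j) \<otimes>\<^bsub>generalized_dihedral A\<^esub> (b, k) =
     (a \<otimes>\<^bsub>A\<^esub> (if j = 0 then b else inv\<^bsub>A\<^esub> b), (j + k) mod 2)"
  by (simp add: generalized_dihedral_def semidirect_product_def)

lemma group_generalized_dihedral:
  assumes "comm_group A"
  shows "group (generalized_dihedral A)"
proof -
  interpret A: comm_group A by fact
  show ?thesis
  proof (rule groupI)
    fix x assume "x \<in> carrier (generalized_dihedral A)"
    then obtain a k where x: "x = (a, k)" "a \<in> carrier A" "k = 0 \<or> k = 1"
      by (auto simp: carrier_generalized_dihedral)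
    then have "(if k = 0 then inv\<^bsub>A\<^esub> a else a, k) \<otimes>\<^bsub>generalized_dihedral A\<^esub> x =
               \<one>\<^bsub>generalized_dihedral A\<^esub>"
      by (auto simp: mult_generalized_dihedral one_generalized_dihedral)
    moreover have "(if k = 0 then inv\<^bsub>A\<^esub> a else a, k) \<in> carrier (generalized_dihedral A)"
      using x by (auto simp: carrier_generalized_dihedral)
    ultimately show "\<exists>y\<in>carrier (generalized_dihedral A).
        y \<otimes>\<^bsub>generalized_dihedral A\<^esub> x = \<one>\<^bsub>generalized_dihedral A\<^esub>"
      by blast
  qed (auto simp: carrier_generalized_dihedral mult_generalized_dihedral
         one_generalized_dihedral A.m_assoc A.inv_mult)
qed

lemma generalized_dihedral_relation:
  assumes "comm_group A" "a \<in> carrier A"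
  defines "D \<equiv> generalized_dihedral A"
  defines "x \<equiv> (\<one>\<^bsub>A\<^esub>, 1)"
  shows "inv\<^bsub>D\<^esub> x \<otimes>\<^bsub>D\<^esub> (a, 0) \<otimes>\<^bsub>D\<^esub> x = inv\<^bsub>D\<^esub> (a, 0)"
proof -
  interpret A: comm_group A by fact
  interpret D: group D
    unfolding D_def by (rule group_generalized_dihedral) fact
  have "inv\<^bsub>D\<^esub> x = x"
    by (rule D.inv_equality)
       (auto simp: x_def D_def carrier_generalized_dihedral mult_generalized_dihedral
          one_generalized_dihedral)
  moreover have "inv\<^bsub>D\<^esub> (a, 0) = (inv\<^bsub>A\<^esub> a, 0)"
    using assms(2) by (intro D.inv_equality)
       (auto simp: D_def carrier_generalized_dihedral mult_generalized_dihedral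
          one_generalized_dihedral)
  ultimately show ?thesis
    using assms(2) by (simp add: x_def D_def mult_generalized_dihedral)
qed

lemma generalized_dihedral_cong:
  assumes "comm_group A" "comm_group B" "A \<cong> B"
  shows "generalized_dihedral A \<cong> generalized_dihedral B"
proof -
  interpret A: comm_group A by fact
  interpret B: comm_group B by fact
  from assms(3) obtain f where f: "f \<in> iso A B" by (auto simp: is_iso_def)
  then interpret f: group_hom A B f
    by unfold_locales (auto simp: iso_def)
  have "map_prod f id \<in> iso (generalized_dihedral A) (generalized_dihedral B)"
  proof (rule isoI)
    show "map_prod f id \<in> hom (generalized_dihedral A) (generalized_dihedral B)"
      by (auto simp: hom_def carrier_generalized_dihedral mult_generalized_dihedral)
    have "bij_betw f (carrier A) (carrier B)"
      using f by (simp add: iso_def)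
    then show "bij_betw (map_prod f id) (carrier (generalized_dihedral A))
                 (carrier (generalized_dihedral B))"
      unfolding carrier_generalized_dihedral
      by (intro bij_betw_map_prod) (auto simp: bij_betw_def)
  qed
  then show ?thesis by (auto simp: is_iso_def)
qed

lemma is_generalized_dihedralI:
  fixes G :: "('a, 'b) monoid_scheme" and A :: "('c, 'd) monoid_scheme"
  assumes "group G" "comm_group A" "finite (carrier A)" "G \<cong> generalized_dihedral A"
  shows "is_generalized_dihedral G"
proof -
  interpret A: comm_group A by fact
  have "generalized_dihedral A \<cong> G"
    using assms by (simp add: group.iso_sym)
  then obtain h where h: "h \<in> iso (generalized_dihedral A) G"
    by (auto simp: is_iso_def)
  define f where "f a = h (a, 0)" for a
  have "inj_on h (carrier A \<times> {0, 1})"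
    using h by (simp add: iso_def bij_betw_def carrier_generalized_dihedral)
  then have inj: "inj_on f (carrier A)"
    by (auto simp: f_def inj_on_def)
  define B where "B = image_group f A"
  have iso: "f \<in> iso A B"
    unfolding B_def by (rule inj_imp_image_group_iso) (rule inj)
  have B: "comm_group B"
    unfolding B_def using A.inj_imp_image_group_is_group[OF inj]
    by (rule group.group_comm_groupI)
       (auto simp: image_group_def inj inv_into_f_f A.m_comm)
  moreover have "finite (carrier B)"
    using assms(3) by (simp add: B_def image_group_def)
  moreover have "generalized_dihedral A \<cong> generalized_dihedral B"
    using generalized_dihedral_cong[OF assms(2) B] iso by (auto simp: is_iso_def)
  then have "G \<cong> generalized_dihedral B"
    using assms(4) iso_trans by blast
  ultimately show ?thesis
    unfolding is_generalized_dihedral_def by blast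
qed

end

theory Submission
  imports Defs
begin

text \<open>
  In the proper commuting graph the closed neighbourhood of a vertex \<open>v\<close> is \<open>C(v) - Z(G)\<close>, so \<open>d\<close> is
  the least size of a closed neighbourhood. Apart from one point, the theorem is a statement about
  finite graphs with this property.

  The bound by half of the vertices is Ore's theorem (\<open>domination_number_le_half\<close>): if no vertex is
  isolated, the complement of a minimum dominating set is dominating as well. This point needs the
  group. An isolated vertex \<open>g\<close> satisfies \<open>C(g) - Z(G) = {g}\<close>; multiplication by a central element
  preserves \<open>C(g) - Z(G)\<close>, so the center is trivial and \<open>C(g) = {1, g}\<close>. The conjugacy class
  \<open>K\<close> of \<open>g\<close> then consists of involutions and fills half of the group, and its complement turns out to
  be an abelian subgroup inverted by \<open>g\<close> (\<open>generalized_dihedral_if_centralizer_order_two\<close>). Hence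
  only generalized dihedral groups have isolated vertices.

  For the logarithmic bound, select every vertex independently with probability \<open>p\<close> and add all
  vertices whose closed neighbourhood was missed. The expected size of this dominating set is at
  most \<open>n (p + (1 - p)^d)\<close> (\<open>domination_number_le_random\<close>). The usual estimate
  \<open>1 - p \<le> exp (- p)\<close> gives \<open>n (1 + ln d) / d\<close>, which is larger than the claimed
  \<open>n (1 + ln (d + 1)) / (d + 1)\<close>. The sharper estimate \<open>ln (1 - p) \<le> - 2 p / (2 - p)\<close> closes this gap for
  \<open>d \<ge> 7\<close>, and well-chosen rational \<open>p\<close> do so for \<open>d = 5\<close> and \<open>d = 6\<close>
  (\<open>ex_probability\<close>). For \<open>d \<le> 4\<close> the logarithmic bound is weaker than Ore's.
\<close>

section \<open>Domination number and Ore's bound\<close>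

context pair_graph
begin

lemma finite_dominating_sets: "finite {S. dominating_set G S}"
  by (rule finite_subset[of _ "Pow (pverts G)"])
     (auto simp: dominating_set_def pair_finite_verts)

lemma domination_number_le_card:
  assumes "dominating_set G S"
  shows "domination_number G \<le> card S"
  unfolding domination_number_def
  using assms finite_dominating_sets by (intro Min_le) auto

lemma ex_minimum_dominating_set:
  obtains S where "dominating_set G S" "card S = domination_number G"
proof -
  have "dominating_set G (pverts G)"
    by (simp add: dominating_set_def)
  then have "domination_number G \<in> card ` {S. dominating_set G S}"
    unfolding domination_number_def
    using finite_dominating_sets by (intro Min_in) auto
  then show thesis
    using that by auto
qed

text \<open>
  Ore's theorem. In a minimum dominating set \<open>S\<close> every vertex \<open>s\<close> has a neighbour outside \<open>S\<close>:
  otherwise its neighbours lie in \<open>S\<close>, one of them dominates \<open>s\<close>, nothing outside \<open>S\<close> relies on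
  \<open>s\<close>, and \<open>s\<close> can be dropped. So the complement of \<open>S\<close> is dominating and not smaller than \<open>S\<close>.
\<close>

lemma domination_number_le_half:
  assumes no_isolated: "\<And>v. v \<in> pverts G \<Longrightarrow> \<exists>u. (v, u) \<in> parcs G"
  shows "2 * domination_number G \<le> card (pverts G)"
proof -
  obtain S where S: "dominating_set G S" and min: "card S = domination_number G"
    by (rule ex_minimum_dominating_set)
  have sub: "S \<subseteq> pverts G" and fin: "finite S"
    using S finite_subset[OF _ pair_finite_verts] by (auto simp: dominating_set_def)
  have "\<exists>u \<in> pverts G - S. (s, u) \<in> parcs G" if s: "s \<in> S" for s
  proof (rule ccontr)
    assume inside: "\<not> ?thesis"
    obtain t where t: "(s, t) \<in> parcs G"
      using no_isolated s sub by blast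
    have "t \<in> S - {s}"
      using t inside in_arcsD2[OF t] pair_no_loops[OF t] by auto
    moreover have "\<exists>x \<in> S - {s}. (y, x) \<in> parcs G" if "y \<in> pverts G - S" for y
      using S that inside arcs_symmetric[of y s] unfolding dominating_set_def by blast
    ultimately have "dominating_set G (S - {s})"
      using S t unfolding dominating_set_def by blast
    then have "card S \<le> card (S - {s})"
      using domination_number_le_card min by simp
    then show False
      using card_Diff1_less[OF fin s] by simp
  qed
  then have "dominating_set G (pverts G - S)"
    unfolding dominating_set_def using sub by blast
  then have "domination_number G \<le> card (pverts G) - card S"
    using domination_number_le_card card_Diff_subset[OF fin sub] by metis
  then show ?thesis
    using min card_mono[OF pair_finite_verts sub] by linarith
qed

end


section \<open>The random dominating set\<close>

text \<open>
  This is the method of conditional expectations. Read \<open>W\<close> as the set of points already decided,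
  and \<open>T\<close> as those selected among them; the remaining points are to be selected independently with
  probability \<open>p\<close>. The left-hand side is the conditional expectation, without the future
  contribution \<open>p\<close> of each undecided point, of the number of selected points plus the number of sets
  \<open>N i\<close> that are missed. Deciding one more point in the better way never raises it above its mean.
\<close>

lemma ex_good_selection:
  fixes p :: real
  assumes "finite W" "finite I" "\<And>i. i \<in> I \<Longrightarrow> finite (N i)" "0 \<le> p" "p \<le> 1"
  shows "\<exists>T \<subseteq> W. real (card T) + (\<Sum>i \<in> {i \<in> I. N i \<inter> T = {}}. (1 - p) ^ card (N i - W))
           \<le> p * card W + (\<Sum>i\<in>I. (1 - p) ^ card (N i))"
  using assms(1)
proof (induction W rule: finite_induct)
  case empty
  then show ?case by simp
next
  case (insert w W)
  then obtain T where T: "T \<subseteq> W"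
    and bound: "real (card T) + (\<Sum>i \<in> {i \<in> I. N i \<inter> T = {}}. (1 - p) ^ card (N i - W))
                  \<le> p * card W + (\<Sum>i\<in>I. (1 - p) ^ card (N i))"
    by blast
  let ?t = "\<lambda>i. (1 - p) ^ card (N i - insert w W)"
  let ?A = "{i \<in> I. N i \<inter> T = {} \<and> w \<notin> N i}" and ?B = "{i \<in> I. N i \<inter> T = {} \<and> w \<in> N i}"
  \<comment> \<open>Skipping \<open>w\<close> leaves \<open>a + b\<close> expected missed sets; selecting it costs one point and leaves \<open>a\<close>.
    So \<open>w\<close> should be selected exactly if \<open>b > 1\<close>.\<close>
  define a where "a = sum ?t ?A"
  define b where "b = sum ?t ?B"
  have split: "sum f {i \<in> I. N i \<inter> T = {}} = sum f ?A + sum f ?B" for f :: "_ \<Rightarrow> real"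
    by (subst sum.union_disjoint[symmetric]) (use assms(2) in \<open>auto intro: sum.cong\<close>)
  have "(1 - p) ^ card (N i - W) = ?t i" if "i \<in> ?A" for i
  proof -
    have "N i - insert w W = N i - W" using that by auto
    then show ?thesis by simp
  qed
  moreover have "(1 - p) ^ card (N i - W) = (1 - p) * ?t i" if "i \<in> ?B" for i
  proof -
    have "N i - W = insert w (N i - insert w W)" using that insert.hyps by auto
    moreover have "finite (N i - insert w W)" using assms(3) that by auto
    ultimately have "card (N i - W) = Suc (card (N i - insert w W))"
      using card_insert_disjoint[of "N i - insert w W" w] by (metis DiffD2 insertI1)
    then show ?thesis by simp
  qed
  ultimately have old: "(\<Sum>i \<in> {i \<in> I. N i \<inter> T = {}}. (1 - p) ^ card (N i - W)) = a + (1 - p) * b"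
    unfolding split a_def b_def sum_distrib_left by (intro arg_cong2[of _ _ _ _ "(+)"] sum.cong refl)
  have cardT: "card (insert w T) = Suc (card T)"
    using T insert.hyps finite_subset[of T W] by (intro card_insert_disjoint) auto
  have cardW: "real (card (insert w W)) = card W + 1"
    using insert.hyps by simp
  show ?case
  proof (cases "b \<le> 1")
    case True
    then have "p * b \<le> p"
      using assms(4) by (simp add: mult_left_le)
    then have "real (card T) + (\<Sum>i \<in> {i \<in> I. N i \<inter> T = {}}. ?t i)
        \<le> p * card (insert w W) + (\<Sum>i\<in>I. (1 - p) ^ card (N i))"
      using bound unfolding old cardW split a_def[symmetric] b_def[symmetric]
      by (simp add: algebra_simps)
    then show ?thesis
      using T by blast
  next
    case False
    then have "1 - p \<le> (1 - p) * b"
      using assms(5) by (simp add: mult_le_cancel_left1)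
    moreover have "{i \<in> I. N i \<inter> insert w T = {}} = ?A"
      by auto
    ultimately have "real (card (insert w T)) + (\<Sum>i \<in> {i \<in> I. N i \<inter> insert w T = {}}. ?t i)
        \<le> p * card (insert w W) + (\<Sum>i\<in>I. (1 - p) ^ card (N i))"
      using bound unfolding old cardW cardT a_def[symmetric]
      by (simp add: algebra_simps a_def)
    then show ?thesis
      using T by blast
  qed
qed

lemma (in pair_graph) domination_number_le_random:
  fixes p :: real
  assumes p: "0 \<le> p" "p \<le> 1"
    and large: "\<And>v. v \<in> pverts G \<Longrightarrow> D \<le> card (insert v {u. (v, u) \<in> parcs G})"
  shows "real (domination_number G) \<le> card (pverts G) * (p + (1 - p) ^ D)"
proof -
  let ?V = "pverts G" and ?N = "\<lambda>v. insert v {u. (v, u) \<in> parcs G}"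
  have sub: "?N v \<subseteq> ?V" if "v \<in> ?V" for v
    using that in_arcsD2 by auto
  then have "\<exists>T \<subseteq> ?V. real (card T) + (\<Sum>v \<in> {v \<in> ?V. ?N v \<inter> T = {}}. (1 - p) ^ card (?N v - ?V))
           \<le> p * card ?V + (\<Sum>v\<in>?V. (1 - p) ^ card (?N v))"
    using finite_subset[OF _ pair_finite_verts] by (intro ex_good_selection pair_finite_verts p) simp
  then obtain T where T: "T \<subseteq> ?V"
    and bound: "real (card T) + (\<Sum>v \<in> {v \<in> ?V. ?N v \<inter> T = {}}. (1 - p) ^ card (?N v - ?V))
           \<le> p * card ?V + (\<Sum>v\<in>?V. (1 - p) ^ card (?N v))"
    by blast
  define U where "U = {v \<in> ?V. ?N v \<inter> T = {}}"
  have "(1 - p) ^ card (?N v - ?V) = 1" if "v \<in> U" for v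
  proof -
    have "?N v - ?V = {}" using sub that unfolding U_def by blast
    then show ?thesis by (metis card.empty power_0)
  qed
  then have "(\<Sum>v \<in> {v \<in> ?V. ?N v \<inter> T = {}}. (1 - p) ^ card (?N v - ?V)) = card U"
    unfolding U_def[symmetric] by simp
  moreover have "(\<Sum>v\<in>?V. (1 - p) ^ card (?N v)) \<le> (\<Sum>v\<in>?V. (1 - p) ^ D)"
    using p large by (intro sum_mono power_decreasing) auto
  moreover have "dominating_set G (T \<union> U)"
    using T unfolding dominating_set_def U_def by blast
  then have "domination_number G \<le> card T + card U"
    using domination_number_le_card card_Un_le le_trans by blast
  ultimately show ?thesis
    using bound by (simp add: algebra_simps)
qed


section \<open>The optimised probability\<close>

text \<open>The first two terms of the power series of \<^const>\<open>artanh\<close>, all of whose coefficients are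
  nonnegative. Through \<open>ln y = 2 artanh ((y - 1) / (y + 1))\<close> this bounds logarithms from below; the
  cubic term is what makes the bound for \<open>ln 6\<close> below precise enough.\<close>

lemma artanh_ge:
  fixes x :: real
  assumes "0 \<le> x" "x < 1"
  shows "x + x ^ 3 / 3 \<le> artanh x"
proof -
  have "artanh 0 - (0 + 0 ^ 3 / 3) \<le> artanh x - (x + x ^ 3 / 3)"
  proof (rule DERIV_nonneg_imp_nondecreasing[OF assms(1)])
    fix y :: real
    assume y: "0 \<le> y" "y \<le> x"
    have y2: "y\<^sup>2 < 1"
      using y assms by (simp add: abs_square_less_1)
    have "((\<lambda>x. artanh x - (x + x ^ 3 / 3)) has_real_derivative 1 / (1 - y\<^sup>2) - (1 + y\<^sup>2)) (at y)"
      using y assms by (auto intro!: derivative_eq_intros)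
    moreover have "(1 + y\<^sup>2) * (1 - y\<^sup>2) \<le> 1"
      by (simp add: algebra_simps)
    then have "1 / (1 - y\<^sup>2) - (1 + y\<^sup>2) \<ge> 0"
      using y2 by (simp add: pos_le_divide_eq)
    ultimately show "\<exists>z. ((\<lambda>x. artanh x - (x + x ^ 3 / 3)) has_real_derivative z) (at y) \<and> 0 \<le> z"
      by blast
  qed
  then show ?thesis by simp
qed

lemma ln_ge:
  fixes y :: real
  assumes "1 \<le> y"
  defines "x \<equiv> (y - 1) / (y + 1)"
  shows "2 * x + 2 * x ^ 3 / 3 \<le> ln y"
proof -
  have "x < 1" "0 \<le> x" "(1 + x) / (1 - x) = y"
    using assms by (auto simp: x_def field_simps)
  then show ?thesis
    using artanh_ge[of x] by (simp add: artanh_def)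
qed

lemma ln_lower_bounds:
  "145 / 81 \<le> ln (6::real)" "1924 / 1000 \<le> ln (7::real)"
  "2 \<le> ln (8::real)" "3 / 2 \<le> ln (5::real)" "1 \<le> ln (4::real)" "1 / 2 \<le> ln (3::real)"
proof -
  have l2: "56 / 81 \<le> ln (2::real)" and l32: "304 / 750 \<le> ln (3 / 2 :: real)"
    and l43: "296 / 1029 \<le> ln (4 / 3 :: real)" and l54: "2 / 9 \<le> ln (5 / 4 :: real)"
    and l76: "2 / 13 \<le> ln (7 / 6 :: real)"
    using ln_ge[of 2] ln_ge[of "3 / 2"] ln_ge[of "4 / 3"] ln_ge[of "5 / 4"] ln_ge[of "7 / 6"]
    by (simp_all add: power3_eq_cube)
  \<comment> \<open>Splitting 6 into factors close to 1 keeps the error of the cubic estimate small.\<close>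
  have "ln (6::real) = ln ((3 / 2) ^ 3 * (4 / 3) ^ 2)"
    by (simp add: eval_nat_numeral)
  also have "\<dots> = 3 * ln (3 / 2) + 2 * ln (4 / 3)"
    by (simp only: ln_mult ln_realpow) (simp add: ln_mult ln_realpow)
  finally have l6: "1791 / 1000 \<le> ln (6::real)"
    using l32 l43 by simp
  then show "145 / 81 \<le> ln (6::real)" by simp
  show "1924 / 1000 \<le> ln (7::real)"
    using l6 l76 ln_mult[of 6 "7 / 6"] by simp
  have l4: "ln (4::real) = 2 * ln 2"
    using ln_realpow[of "2::real" 2] by simp
  show "2 \<le> ln (8::real)"
    using l2 ln_realpow[of "2::real" 3] by simp
  show "1 \<le> ln (4::real)"
    using l2 l4 by simp
  show "3 / 2 \<le> ln (5::real)"
    using l2 l4 l54 ln_mult[of 4 "5 / 4"] by simp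
  show "1 / 2 \<le> ln (3::real)"
    using l2 l32 ln_mult[of 2 "3 / 2"] by simp
qed

text \<open>
  The natural choice \<open>p = ln (d + 1) / (d + 1)\<close> leaves \<open>(1 - p)^d \<le> 1 / (d + 1)\<close> to be shown. As
  \<open>- ln (1 - p) \<ge> 2 p / (2 - p)\<close>, it suffices that \<open>2 d \<ge> (d + 1) (2 - p)\<close>, that is
  \<open>ln (d + 1) \<ge> 2\<close>, which holds from \<open>d = 7\<close> on. For \<open>d = 5\<close> the natural choice fails: the true minimum of
  \<open>p + (1 - p)^5\<close> is below the target by less than \<open>0.0003\<close>, and \<open>p = 1 / 3\<close> is close enough to it.
\<close>

lemma ex_probability:
  assumes "5 \<le> d"
  obtains p :: real where "0 \<le> p" "p \<le> 1" "p + (1 - p) ^ d \<le> (1 + ln (real d + 1)) / (real d + 1)"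
proof -
  consider "d = 5" | "d = 6" | "7 \<le> d"
    using assms by linarith
  then show thesis
  proof cases
    case 1
    then show thesis
      using ln_lower_bounds(1) by (intro that[of "1 / 3"]) (simp_all add: eval_nat_numeral)
  next
    case 2
    then show thesis
      using ln_lower_bounds(2) by (intro that[of "3 / 10"]) (simp_all add: eval_nat_numeral)
  next
    case 3
    define m where "m = real d + 1"
    define p where "p = ln m / m"
    have m: "8 \<le> m" using 3 by (simp add: m_def)
    then have "ln 8 \<le> ln m" by simp
    then have "2 \<le> ln m"
      using ln_lower_bounds(3) by linarith
    then have mp: "2 \<le> m * p" using m by (simp add: p_def)
    have p: "0 < p" "p < 1"
      using m ln_less_self[of m] \<open>2 \<le> ln m\<close> by (simp_all add: p_def)
    have x: "(1 / (1 - p) - 1) / (1 / (1 - p) + 1) = p / (2 - p)"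
      using p by (simp add: divide_simps)
    have "0 \<le> 2 * (p / (2 - p)) ^ 3 / 3"
      using p by simp
    moreover have "2 * (p / (2 - p)) + 2 * (p / (2 - p)) ^ 3 / 3 \<le> - ln (1 - p)"
      using ln_ge[of "1 / (1 - p)"] p unfolding x by (simp add: ln_div)
    ultimately have "2 * p / (2 - p) \<le> - ln (1 - p)"
      by linarith
    then have "d * (2 * p / (2 - p)) \<le> d * - ln (1 - p)"
      by (intro mult_left_mono) auto
    moreover have "ln m \<le> d * (2 * p / (2 - p))"
    proof -
      have "m * (2 - p) \<le> 2 * d"
        using mp by (simp add: m_def algebra_simps)
      then have "p * (m * (2 - p)) \<le> p * (2 * d)"
        using p by (intro mult_left_mono) auto
      then have "p * m \<le> d * (2 * p / (2 - p))"
        using p by (simp add: pos_le_divide_eq mult_ac)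
      then show ?thesis using m by (simp add: p_def)
    qed
    ultimately have "ln ((1 - p) ^ d) \<le> ln (1 / m)"
      using p m by (simp add: ln_realpow ln_div)
    then have "(1 - p) ^ d \<le> 1 / m"
      using p m by simp
    then have "p + (1 - p) ^ d \<le> (1 + ln m) / m"
      by (simp add: p_def add_divide_distrib)
    then show thesis
      using that[of p] p by (simp add: m_def add.commute)
  qed
qed

lemma half_le_log_bound:
  assumes "1 \<le> d" "d \<le> 4"
  shows "1 / 2 \<le> (1 + ln (real d + 1)) / (real d + 1)"
proof -
  have "d \<in> {1, 2, 3, 4}" using assms by auto
  then show ?thesis
    using ln_lower_bounds(4-6) by auto
qed


section \<open>Elements with centralizer of order two\<close>

context group
begin

lemma card_conjugacy_class_mult_centralizer:
  assumes "finite (carrier G)" "g \<in> carrier G"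
  shows "card ((\<lambda>x. x \<otimes> g \<otimes> inv x) ` carrier G) * card (centralizer G g) = order G"
proof -
  let ?\<phi> = "\<lambda>x. \<lambda>h \<in> carrier G. x \<otimes> h \<otimes> inv x"
  interpret conj: group_action G "carrier G" ?\<phi>
    by (rule action_by_conjugation)
  have "Group_Action.orbit G ?\<phi> g = (\<lambda>x. x \<otimes> g \<otimes> inv x) ` carrier G"
    using assms(2) by (auto simp: Group_Action.orbit_def)
  moreover have "stabilizer G ?\<phi> g = centralizer G g"
    using assms(2) inv_solve_right'[where a = g and b = "_ \<otimes> g"]
    by (auto simp: stabilizer_def centralizer_def)
  ultimately show ?thesis
    using conj.orbit_stabilizer_theorem[OF assms(2)] by simp
qed

text \<open>
  Recognition of generalized dihedral groups. That \<open>g\<close> inverts \<open>N\<close> makes inversion a homomorphism of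
  \<open>N\<close>, as it is conjugation by \<open>g\<close>, so \<open>N\<close> is abelian; the index condition says that \<open>N\<close> and
  \<open>N g\<close> exhaust the group.
\<close>

lemma generalized_dihedral_if_inverted_subgroup:
  assumes fin: "finite (carrier G)" and N: "subgroup N G" and index: "2 * card N = order G"
    and g: "g \<in> carrier G" "g \<notin> N" "g \<otimes> g = \<one>"
    and inverts: "\<And>n. n \<in> N \<Longrightarrow> g \<otimes> n = inv n \<otimes> g"
  shows "is_generalized_dihedral G"
proof -
  interpret N: subgroup N G by fact
  let ?A = "G\<lparr>carrier := N\<rparr>"
  have comm: "a \<otimes> b = b \<otimes> a" if "a \<in> N" "b \<in> N" for a b
  proof -
    have "inv (a \<otimes> b) \<otimes> g = g \<otimes> (a \<otimes> b)"
      using inverts[of "a \<otimes> b"] that by simp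
    also have "\<dots> = inv a \<otimes> g \<otimes> b"
      using inverts[of a] that g by (simp add: m_assoc[symmetric])
    also have "\<dots> = inv a \<otimes> inv b \<otimes> g"
      using inverts[of b] that g by (simp add: m_assoc)
    finally have "inv (a \<otimes> b) = inv a \<otimes> inv b"
      using that g by simp
    then have "inv (a \<otimes> b) = inv (b \<otimes> a)"
      using that by (simp add: inv_mult_group)
    then show ?thesis
      using that by (metis N.mem_carrier inv_inv m_closed)
  qed
  have "group ?A"
    by (rule subgroup_imp_group) fact
  then have A: "comm_group ?A"
    by (rule group.group_comm_groupI) (use comm in auto)
  interpret D: group "generalized_dihedral ?A"
    by (rule group_generalized_dihedral) fact
  define h where "h = (\<lambda>(n, k::int). if k = 0 then n else n \<otimes> g)"
  have twist: "a \<otimes> g \<otimes> b = a \<otimes> inv b \<otimes> g" if "a \<in> N" "b \<in> N" for a b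
    using that g inverts by (simp add: m_assoc)
  have twist': "a \<otimes> g \<otimes> (b \<otimes> g) = a \<otimes> inv b" if "a \<in> N" "b \<in> N" for a b
  proof -
    have "a \<otimes> g \<otimes> (b \<otimes> g) = a \<otimes> g \<otimes> b \<otimes> g"
      using that g by (simp add: m_assoc)
    also have "\<dots> = a \<otimes> inv b \<otimes> g \<otimes> g"
      using twist that by simp
    finally show ?thesis
      using that g by (simp add: m_assoc)
  qed
  have "h \<in> iso (generalized_dihedral ?A) G"
  proof (rule isoI)
    show "h \<in> hom (generalized_dihedral ?A) G"
      using g by (auto simp: hom_def h_def carrier_generalized_dihedral mult_generalized_dihedral
          m_inv_consistent[OF N] twist twist'
          m_assoc[OF N.mem_carrier N.mem_carrier g(1)])
    have ng: "n \<otimes> g \<notin> N" if "n \<in> N" for n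
    proof
      assume "n \<otimes> g \<in> N"
      then have "inv n \<otimes> (n \<otimes> g) \<in> N" using that by blast
      then show False
        using that g by (simp add: m_assoc[symmetric])
    qed
    then have inj: "inj_on h (N \<times> {0, 1})"
      using g by (auto simp: inj_on_def h_def)
    have "h ` (N \<times> {0, 1}) \<subseteq> carrier G"
      using g by (auto simp: h_def)
    moreover have "card (h ` (N \<times> {0, 1})) = card (carrier G)"
      using inj index by (simp add: card_image card_cartesian_product order_def)
    ultimately have "h ` (N \<times> {0, 1}) = carrier G"
      using fin by (metis card_subset_eq)
    then show "bij_betw h (carrier (generalized_dihedral ?A)) (carrier G)"
      using inj by (simp add: bij_betw_def carrier_generalized_dihedral)
  qed
  then have "G \<cong> generalized_dihedral ?A"
    using D.iso_sym by (auto simp: is_iso_def)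
  then show ?thesis
    using is_generalized_dihedralI[OF is_group A] N.subset fin finite_subset by auto
qed

text \<open>
  The class \<open>K\<close> of \<open>g\<close> has \<open>|G| / 2\<close> elements, and every \<open>k\<close> in \<open>K\<close> is an involution whose
  centralizer is \<open>{1, k}\<close>. If a product \<open>k l\<close> of two elements of \<open>K\<close> were in \<open>K\<close>, it would be
  an involution, so \<open>k\<close> and \<open>l\<close> would commute and be equal, giving \<open>1 \<in> K\<close>. Hence \<open>K k\<close> lies in
  the complement \<open>N\<close> of \<open>K\<close> and equals it by cardinality. Thus \<open>K\<close> and \<open>N\<close> multiply like
  reflections and rotations: \<open>N\<close> is a subgroup of index two, and \<open>n g\<close> is an involution for every
  \<open>n\<close> in \<open>N\<close>, so that \<open>g\<close> inverts \<open>n\<close>.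
\<close>

lemma generalized_dihedral_if_centralizer_order_two:
  assumes fin: "finite (carrier G)" and g: "g \<in> carrier G" "g \<noteq> \<one>"
    and cent: "centralizer G g = {\<one>, g}"
  shows "is_generalized_dihedral G"
proof -
  define K where "K = (\<lambda>x. x \<otimes> g \<otimes> inv x) ` carrier G"
  define N where "N = carrier G - K"
  have "g \<otimes> g \<in> centralizer G g"
    using g by (simp add: centralizer_def m_assoc)
  then have gg: "g \<otimes> g = \<one>"
    using g cent by auto
  have gK: "g \<in> K"
    unfolding K_def using g by (intro image_eqI[of _ _ \<one>]) auto
  have K: "K \<subseteq> carrier G"
    using g by (auto simp: K_def)
  have cardK: "2 * card K = order G"
    using card_conjugacy_class_mult_centralizer[OF fin g(1)] cent g(2)
    by (simp add: K_def mult.commute)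
  have cancel: "inv x \<otimes> (x \<otimes> c) = c" "x \<otimes> (inv x \<otimes> c) = c"
    if "x \<in> carrier G" "c \<in> carrier G" for x c
    using that by (simp_all add: m_assoc[symmetric])
  have conjugate: "x \<otimes> a \<otimes> inv x \<otimes> (x \<otimes> b \<otimes> inv x) = x \<otimes> (a \<otimes> b) \<otimes> inv x"
    if "x \<in> carrier G" "a \<in> carrier G" "b \<in> carrier G" for x a b
    using that by (simp add: m_assoc cancel)
  have square: "k \<otimes> k = \<one>" if k: "k \<in> K" for k
    using k conjugate g gg by (auto simp: K_def)
  have not_one: "\<one> \<notin> K"
  proof
    assume "\<one> \<in> K"
    then obtain x where x: "x \<in> carrier G" "\<one> = x \<otimes> g \<otimes> inv x" by (auto simp: K_def)
    then have "x \<otimes> g = x" using g by (metis inv_solve_right' l_one m_closed one_closed)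
    then show False using x g by simp
  qed
  have selfcent: "h = \<one> \<or> h = k"
    if k: "k \<in> K" and h: "h \<in> carrier G" "h \<otimes> k = k \<otimes> h" for k h
  proof -
    obtain x where x: "x \<in> carrier G" "k = x \<otimes> g \<otimes> inv x"
      using k by (auto simp: K_def)
    define y where "y = inv x \<otimes> h \<otimes> x"
    have y: "y \<in> carrier G" "h = x \<otimes> y \<otimes> inv x"
      using x h by (auto simp: y_def m_assoc cancel)
    have "x \<otimes> (y \<otimes> g) \<otimes> inv x = x \<otimes> (g \<otimes> y) \<otimes> inv x"
      using h(2) x y g by (simp add: conjugate)
    then have "y \<otimes> g = g \<otimes> y"
      using x y g by simp
    then have "y \<in> {\<one>, g}"
      using y cent by (auto simp: centralizer_def)
    then show ?thesis
      using x y by auto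
  qed
  have inv_K: "inv k = k" if "k \<in> K" for k
    using square[OF that] that K by (metis inv_equality subsetD)
  have KK: "k \<otimes> l \<in> N" if kl: "k \<in> K" "l \<in> K" for k l
  proof -
    have "k \<otimes> l \<notin> K"
    proof
      assume klK: "k \<otimes> l \<in> K"
      have "k \<otimes> l = inv (k \<otimes> l)" using inv_K klK by simp
      also have "\<dots> = l \<otimes> k" using kl K inv_K by (simp add: inv_mult_group subset_eq)
      finally have "k = \<one> \<or> k = l" using selfcent kl K by blast
      then show False using kl not_one square klK by auto
    qed
    then show ?thesis using kl K by (auto simp: N_def)
  qed
  have finK: "finite K" using K fin finite_subset by blast
  have cardN: "card N = card K"
    using cardK card_Diff_subset[OF finK K] by (simp add: N_def order_def)
  have NK: "n \<otimes> k \<in> K" if n: "n \<in> N" and k: "k \<in> K" for n k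
  proof -
    have "inj_on (\<lambda>x. x \<otimes> k) K"
      using k K by (auto simp: inj_on_def subset_eq)
    then have "(\<lambda>x. x \<otimes> k) ` K = N"
      using KK k cardN fin by (intro card_subset_eq) (auto simp: card_image N_def)
    then obtain x where "x \<in> K" "n = x \<otimes> k"
      using n by auto
    then show ?thesis
      using k K square by (simp add: m_assoc subset_eq)
  qed
  have inv_N: "inv n \<in> N" if "n \<in> N" for n
    using that inv_K unfolding N_def by (metis Diff_iff inv_closed inv_inv)
  have KN: "k \<otimes> n \<in> K" if n: "n \<in> N" and k: "k \<in> K" for n k
  proof -
    have "inv n \<otimes> k \<in> K" using NK inv_N n k by blast
    moreover have "inv (inv n \<otimes> k) = k \<otimes> n"
      using n k K inv_K by (auto simp: inv_mult_group N_def subset_eq)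
    ultimately show ?thesis using inv_K by simp
  qed
  have sub: "subgroup N G"
  proof (rule subgroupI)
    show "N \<noteq> {}" using not_one by (auto simp: N_def)
    fix a b assume ab: "a \<in> N" "b \<in> N"
    then have carr: "a \<in> carrier G" "b \<in> carrier G" by (auto simp: N_def)
    have "a \<otimes> b \<notin> K"
    proof
      assume "a \<otimes> b \<in> K"
      then have "a \<otimes> b \<otimes> inv b \<in> K" using KN inv_N ab by blast
      then show False using ab carr by (simp add: m_assoc N_def)
    qed
    then show "a \<otimes> b \<in> N" using carr by (simp add: N_def)
  qed (auto simp: inv_N, simp add: N_def)
  have "g \<otimes> n = inv n \<otimes> g" if n: "n \<in> N" for n
  proof -
    have "inv (inv n \<otimes> g) = inv n \<otimes> g" using NK inv_N n gK inv_K by blast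
    then show ?thesis using n g inv_K gK by (auto simp: inv_mult_group N_def)
  qed
  then show ?thesis
    using generalized_dihedral_if_inverted_subgroup[OF fin sub, of g] cardN cardK g gK gg
    by (simp add: N_def)
qed

text \<open>
  For central \<open>z\<close> the product \<open>z g\<close> again lies in \<open>C(g)\<close> and outside the center, so \<open>z g = g\<close>: an
  isolated vertex forces a trivial center.
\<close>

lemma generalized_dihedral_if_centralizer_excess_one:
  assumes fin: "finite (carrier G)" and g: "g \<in> carrier G" "g \<notin> group_center G"
    and excess: "centralizer G g - group_center G = {g}"
  shows "is_generalized_dihedral G"
proof (rule generalized_dihedral_if_centralizer_order_two[OF fin g(1)])
  have one: "\<one> \<in> group_center G" by (simp add: group_center_def)
  then show "g \<noteq> \<one>" using g by auto
  have "z = \<one>" if z: "z \<in> group_center G" for z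
  proof -
    have zG: "z \<in> carrier G" and zc: "\<And>x. x \<in> carrier G \<Longrightarrow> z \<otimes> x = x \<otimes> z"
      using z by (auto simp: group_center_def)
    have "z \<otimes> g \<in> centralizer G g"
      using zG zc[of g] g by (simp add: centralizer_def m_assoc)
    moreover have "z \<otimes> g \<notin> group_center G"
    proof
      assume c: "z \<otimes> g \<in> group_center G"
      have "g \<otimes> x = x \<otimes> g" if x: "x \<in> carrier G" for x
      proof -
        have "z \<otimes> (g \<otimes> x) = z \<otimes> g \<otimes> x" using zG g x by (simp add: m_assoc)
        also have "\<dots> = x \<otimes> (z \<otimes> g)" using c x by (simp add: group_center_def)
        also have "\<dots> = z \<otimes> (x \<otimes> g)" using zc[OF x] zG g x by (simp add: m_assoc[symmetric])
        finally show ?thesis using zG g x by simp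
      qed
      then show False using g by (simp add: group_center_def)
    qed
    ultimately have "z \<otimes> g = g" using excess by blast
    then show ?thesis using zG g by simp
  qed
  then have "group_center G = {\<one>}" using one by blast
  then show "centralizer G g = {\<one>, g}"
    using excess group_center_subset_centralizer[OF g(1)] by auto
qed

end


section \<open>The proper commuting graph\<close>

lemma closed_neighbourhood_proper_commuting_graph:
  assumes "v \<in> pverts (proper_commuting_graph G)"
  shows "insert v {u. (v, u) \<in> parcs (proper_commuting_graph G)}
           = centralizer G v - group_center G"
  using assms by (auto simp: proper_commuting_graph_def centralizer_def)

theorem theorem1p3:
  fixes G :: "('a, 'b) monoid_scheme" and d :: nat
  assumes "group G" and "finite (carrier G)" and "\<not> comm_group G"
    and "\<not> is_generalized_dihedral G"
  defines "d \<equiv> min_centralizer_excess G"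
  shows "real (domination_number (proper_commuting_graph G))
           \<le> (real (order G) - real (card (group_center G)))
              * min ((1 + ln (real d + 1)) / (real d + 1)) (1 / 2)"
proof -
  interpret G: group G by fact
  let ?\<Gamma> = "proper_commuting_graph G" and ?Z = "group_center G"
  interpret pair_graph ?\<Gamma>
    by (rule pair_graph_proper_commuting_graph) fact
  have V: "pverts ?\<Gamma> = carrier G - ?Z"
    by (simp add: proper_commuting_graph_def)
  have ZG: "?Z \<subseteq> carrier G"
    by (auto simp: group_center_def)
  have finZ: "finite ?Z"
    using ZG assms(2) finite_subset by blast
  have card_V: "real (card (pverts ?\<Gamma>)) = real (order G) - real (card ?Z)"
    unfolding V using card_Diff_subset[OF finZ ZG] card_mono[OF assms(2) ZG]
    by (simp add: order_def of_nat_diff)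
  have excess: "card (centralizer G v) - card ?Z = card (insert v {u. (v, u) \<in> parcs ?\<Gamma>})"
    if "v \<in> pverts ?\<Gamma>" for v
    using that card_Diff_subset[OF finZ group_center_subset_centralizer, of v]
    by (simp add: closed_neighbourhood_proper_commuting_graph V)
  have "pverts ?\<Gamma> \<noteq> {}"
    unfolding V using assms(3) G.group_comm_groupI by (fastforce simp: group_center_def)
  then have ne: "(\<lambda>v. card (centralizer G v) - card ?Z) ` pverts ?\<Gamma> \<noteq> {}"
    by simp
  have fin: "finite ((\<lambda>v. card (centralizer G v) - card ?Z) ` pverts ?\<Gamma>)"
    using pair_finite_verts by simp
  have d_le: "d \<le> card (insert v {u. (v, u) \<in> parcs ?\<Gamma>})" if "v \<in> pverts ?\<Gamma>" for v
    unfolding d_def min_centralizer_excess_def V[symmetric] excess[OF that, symmetric]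
    using fin that by (intro Min_le) auto
  have finN: "finite {u. (v, u) \<in> parcs ?\<Gamma>}" for v
    by (rule finite_subset[OF _ pair_finite_verts]) (auto dest: in_arcsD2)
  \<comment> \<open>The minimum is attained, and a closed neighbourhood contains its own vertex.\<close>
  have "d \<in> (\<lambda>v. card (centralizer G v) - card ?Z) ` pverts ?\<Gamma>"
    unfolding d_def min_centralizer_excess_def V[symmetric] using fin ne by (rule Min_in)
  then have "1 \<le> d"
    using excess finN by (auto simp: card_insert_if card_gt_0_iff Suc_le_eq)
  have "\<exists>u. (v, u) \<in> parcs ?\<Gamma>" if v: "v \<in> pverts ?\<Gamma>" for v
  proof (rule ccontr)
    assume "\<not> ?thesis"
    then have "centralizer G v - ?Z = {v}"
      using closed_neighbourhood_proper_commuting_graph[OF v] by auto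
    then show False
      using G.generalized_dihedral_if_centralizer_excess_one assms(2,4) v V by auto
  qed
  then have "2 * domination_number ?\<Gamma> \<le> card (pverts ?\<Gamma>)"
    by (rule domination_number_le_half)
  then have half: "real (domination_number ?\<Gamma>) \<le> card (pverts ?\<Gamma>) * (1 / 2)"
    by simp
  have "real (domination_number ?\<Gamma>) \<le> card (pverts ?\<Gamma>) * ((1 + ln (real d + 1)) / (real d + 1))"
  proof (cases "d \<le> 4")
    case True
    have "card (pverts ?\<Gamma>) * (1 / 2) \<le> card (pverts ?\<Gamma>) * ((1 + ln (real d + 1)) / (real d + 1))"
      using half_le_log_bound[OF \<open>1 \<le> d\<close> True] by (intro mult_left_mono) auto
    then show ?thesis
      using half by linarith
  next
    case False
    then obtain p :: real where p: "0 \<le> p" "p \<le> 1"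
      and le: "p + (1 - p) ^ d \<le> (1 + ln (real d + 1)) / (real d + 1)"
      using ex_probability[of d] by auto
    have "real (domination_number ?\<Gamma>) \<le> card (pverts ?\<Gamma>) * (p + (1 - p) ^ d)"
      using p d_le by (rule domination_number_le_random)
    also have "\<dots> \<le> card (pverts ?\<Gamma>) * ((1 + ln (real d + 1)) / (real d + 1))"
      using le by (intro mult_left_mono) auto
    finally show ?thesis .
  qed
  then show ?thesis
    using half unfolding card_V[symmetric] min_def by simp
qed

end
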